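(* Let the pair $\{\mathbf{\Psi}_x^\star, \mathbf{\Psi}_u^\star\}$ of system responses be a solution of the following convex problem over pairs of system responses, i.e. over block-lower-triangular matrices $\mathbf{\Psi}_x \in \mathbb{R}^{(T+1)n\times(T+1)n}$, $\mathbf{\Psi}_u\in\mathbb{R}^{Tm\times(T+1)n}$: $$\text{minimize } \tilde f(\mathbf{\Psi}_x,\mathbf{\Psi}_u):=\left\Vert \mathbf{F}^{\frac12}\begin{bmatrix}\mathbf{\Psi}_x\\ \mathbf{\Psi}_u\end{bmatrix}\mathbf{\Lambda}^{\frac12}\right\Vert_F^2$$ subject to $$\mathbf{Z}_{\mathbf{A},\mathbf{B}}\begin{bmatrix}\mathbf{\Psi}_x\\ \mathbf{\Psi}_u\end{bmatrix}=\mathbf{V},\qquad \begin{bmatrix}\mathbf{\Psi}_x\\ \mathbf{\Psi}_u\end{bmatrix}\mathbf{V}^\top\in\mathcal{L}_d,\qquad \mathbf{P}_T\mathbf{\Psi}_x\mathbf{V}^\top\mathbf{P}_0^\top\mu_0=\mu_f,$$ $$\begin{bmatrix}\Sigma_f & \mathbf{P}_T\mathbf{\Psi}_x\mathbf{V}^\top\mathbf{\Sigma}_{\mathbf{w}}^{\frac12}\\ \big(\mathbf{P}_T\mathbf{\Psi}_x\mathbf{V}^\top\mathbf{\Sigma}_{\mathbf{w}}^{\frac12}\big)^\top & I\end{bmatrix}\succeq 0 ,$$ where $\mathbf{\Lambda}$ is a diagonal matrix whose entries are the eigenvalues of $\mathbf{\Theta}$ and $\mathbf{V}$ is an orthogonal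 matrix satisfying $\mathbf{\Theta}=\mathbf{V}\mathbf{\Lambda}\mathbf{V}^\top$. Then the pair $\{\mathbf{\Phi}_x^\star,\mathbf{\Phi}_u^\star\}$ of system responses, where $\mathbf{\Phi}_x^\star := \mathbf{\Psi}_x^\star\mathbf{V}^\top$ and $\mathbf{\Phi}_u^\star := \mathbf{\Psi}_u^\star\mathbf{V}^\top$, is a solution of the localized SLS covariance steering problem, namely the following convex problem over pairs of system responses, i.e. over block-lower-triangular matrices $\mathbf{\Phi}_x\in \mathbb{R}^{(T+1)n\times(T+1)n}$, $\mathbf{\Phi}_u\in\mathbb{R}^{Tm\times(T+1)n}$: $$\text{minimize } f(\mathbf{\Phi}_x,\mathbf{\Phi}_u):=\left\Vert \mathbf{F}^{\frac12}\begin{bmatrix}\mathbf{\Phi}_x\\ \mathbf{\Phi}_u\end{bmatrix}\mathbf{\Theta}^{\frac12}\right\Vert_F^2$$ subject to $$\mathbf{Z}_{\mathbf{A},\mathbf{B}}\begin{bmatrix}\mathbf{\Phi}_x\\ \mathbf{\Phi}_u\end{bmatrix}=I,\qquad \begin{bmatrix}\mathbf{\Phi}_x\\ \mathbf{\Phi}_u\end{bmatrix}\in\mathcal{L}_d,\qquad \mathbf{P}_T\mathbf{\Phi}_x\mathbf{P}_0^\top\mu_0=\mu_f,$$ $$\begin{bmatrix}\Sigma_f & \mathbf{P}_T\mathbf{\Phi}_x\mathbf{\Sigma}_{\mathbf{w}}^{\frac12}\\ \big(\mathbf{P}_T\mathbf{\Phi}_x\mathbf{\Sigma}_{\mathbf{w}}^{\frac12}\big)^\top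 & I\end{bmatrix}\succeq 0 .$$
   Context: $\mathbb{S}^n_+$ and $\mathbb{S}^n_{++}$ denote the real symmetric positive semidefinite and positive definite $n\times n$ matrices; $\|\cdot\|_F$ is the Frobenius norm; $M^{1/2}$ is the positive semidefinite square root of a positive semidefinite matrix $M$; $M \succeq 0$ means positive semidefinite; $\mathbb{N}$ is the set of non-negative integers. System. There are $N$ subsystems with state dimensions $n_i$ and input dimensions $m_i$; $n=\sum_i n_i$, $m=\sum_i m_i$. The global dynamics are $x_{t+1}=A_tx_t+B_tu_t+w_t$, $t=0,\dots,T-1$, with $A_t\in\mathbb{R}^{n\times n}$ having blocks $A_t^{ij}\in\mathbb{R}^{n_i\times n_j}$ and $B_t=\mathrm{blkdiag}(B_t^1,\dots,B_t^N)$, $B_t^i\in\mathbb{R}^{n_i\times m_i}$. The local states, inputs and disturbances are $x_t^i\in\mathbb{R}^{n_i}$, $u_t^i\in\mathbb{R}^{m_i}$, $w_t^i\in\mathbb{R}^{n_i}$. Each $w_t^i$ is zero-mean white Gaussian noise with covariance $S_i\in\mathbb{S}^{n_i}_{++}$, and $W_t:=\mathrm{Cov}[w_t]$. The initial state is $x_0\sim\mathcal{N}(\mu_0,\Sigma_0)$. The horizon is $T\in\mathbb{N}$. The data are $\mu_0,\mu_f\in\mathbb{R}^n$ (with $\mu_f=0$ assumed without loss of generality), $\Sigma_0,\Sigma_f\in\mathbb{S}^n_{++}$, $Q_t\in\mathbb{S}^n_+$ and $R_t\in\mathbb{S}^m_{++}$ for $t=0,\dots,T-1$, and a locality parameter $d\in\mathbb{N}$.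 It is assumed that, for the given $d$, the localized SLS covariance steering problem is feasible. Stacked matrices. - $\mathbf{A}:=[\,\mathrm{blkdiag}(A_0,\dots,A_{T-1})\;\;0_{Tn\times n}]$ and $\mathbf{B}:=\mathrm{blkdiag}(B_0,\dots,B_{T-1})$. - $\mathbf{Z}\in\mathbb{R}^{(T+1)n\times Tn}$ is the block-lower shift matrix: $n\times n$ identity blocks on the first block subdiagonal and zeros elsewhere. - $\mathbf{Z}_{\mathbf{A},\mathbf{B}}:=[\,I-\mathbf{Z}\mathbf{A}\;\;-\mathbf{Z}\mathbf{B}]$. - $\mathbf{Q}:=\mathrm{blkdiag}(Q_0,\dots,Q_{T-1},0)$ (last block $n\times n$), $\mathbf{R}:=\mathrm{blkdiag}(R_0,\dots,R_{T-1})$, $\mathbf{F}:=\mathrm{blkdiag}(\mathbf{Q},\mathbf{R})$. - $\mathbf{P}_t$ is the $1\times(T+1)$ block matrix of $n\times n$ blocks, all zero except the $(t+1)$-th, which is the identity. - $\boldsymbol{\mu}_{\mathbf{w}}:=[\mu_0^\top,0^\top]^\top\in\mathbb{R}^{(T+1)n}$, $\mathbf{\Sigma}_{\mathbf{w}}:=\mathrm{blkdiag}(\Sigma_0,W_0,\dots,W_{T-1})$, $\mathbf{\Theta}:=\mathbf{\Sigma}_{\mathbf{w}}+\boldsymbol{\mu}_{\mathbf{w}}\boldsymbol{\mu}_{\mathbf{w}}^\top$. Block-lower-triangular. A matrix in $\mathbb{R}^{(T+1)n\times(T+1)n}$ (partitioned into $(T+1)\times(T+1)$ blocks of size $n\times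 n$) or in $\mathbb{R}^{Tm\times(T+1)n}$ (partitioned into $T\times(T+1)$ blocks of size $m\times n$) is block-lower-triangular if its $(t,t')$ block vanishes whenever $t'>t$, with block rows and block columns indexed from $0$. The decision variables, called (state and control) system responses, are taken from the sets of block-lower-triangular matrices of these dimensions. Locality. The system graph is $\mathcal{G}=(\mathcal{V},\mathcal{E})$ with $\mathcal{V}=\{1,\dots,N\}$ and $(i,j)\in\mathcal{E}$ iff $A_t^{ji}\neq0$ for some $t$. $\mathrm{dist}(i,j)$ is the number of edges in a shortest directed path from $i$ to $j$, and $\mathcal{O}_i(d):=\{j\in\mathcal{V}:\mathrm{dist}(i,j)\le d\}$. For $\mathbf{\Phi}_x$ (respectively $\mathbf{\Phi}_u$), $[\mathbf{\Phi}_x]^{ij}$ (respectively $[\mathbf{\Phi}_u]^{ij}$) denotes the submatrix mapping the local noise history $[x_0^{j\top},w_0^{j\top},\dots,w_{T-1}^{j\top}]^\top$ of subsystem $j$ to the local state history $[x_0^{i\top},\dots,x_T^{i\top}]^\top$ (respectively local input history $[u_0^{i\top},\dots,u_{T-1}^{i\top}]^\top$) of subsystem $i$, under $\mathbf{x}=\mathbf{\Phi}_x\mathbf{w}$, $\mathbf{u}=\mathbf{\Phi}_u\mathbf{w}$, where $\mathbf{x}=[x_0^\top,\dots,x_T^\top]^\top$, $\mathbf{u}=[u_0^\top,\dots,u_{T-1}^\top]^\top$, $\mathbf{w}=[x_0^\top,w_0^\top,\dots,w_{T-1}^\top]^\top$. The matrix $\mathbf{\Phi}_\bullet$ is $d$-localized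 if $[\mathbf{\Phi}_\bullet]^{ij}=0$ for all $j\in\mathcal{V}$ and all $i\notin\mathcal{O}_j(d)$. $\mathcal{L}_d$ is a $d$-locality constraint: a linear subspace such that $\begin{bmatrix}\mathbf{\Phi}_x\\ \mathbf{\Phi}_u\end{bmatrix}\in\mathcal{L}_d$ implies that $\mathbf{\Phi}_x$ is $d$-localized and $\mathbf{\Phi}_u$ is $(d+1)$-localized. *)

theory Defs
  imports "HOL-Probability.Probability" "HOL-Library.Extended_Nat"
    "Jordan_Normal_Form.Char_Poly" "Jordan_Normal_Form.VS_Connect"
begin

unbundle no vec_syntax and no inner_syntax

hide_type (open) Finite_Cartesian_Product.vec
hide_const (open) Finite_Cartesian_Product.vec

section \<open>Matrices\<close>

definition psd_mats :: "nat \<Rightarrow> real mat set" where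
  "psd_mats k = {M \<in> carrier_mat k k. transpose_mat M = M \<and>
     (\<forall>v \<in> carrier_vec k. 0 \<le> scalar_prod v (M *\<^sub>v v))}"

definition pd_mats :: "nat \<Rightarrow> real mat set" where
  "pd_mats k = {M \<in> carrier_mat k k. transpose_mat M = M \<and>
     (\<forall>v \<in> carrier_vec k. v \<noteq> 0\<^sub>v k \<longrightarrow> 0 < scalar_prod v (M *\<^sub>v v))}"

definition psd_sqrt :: "real mat \<Rightarrow> real mat" where
  "psd_sqrt M = (THE X. X \<in> psd_mats (dim_row M) \<and> X * X = M)"

definition frob_norm :: "real mat \<Rightarrow> real" where
  "frob_norm M = sqrt (\<Sum>i<dim_row M. \<Sum>j<dim_col M. (M $$ (i, j))\<^sup>2)"

definition orthogonal_matrix_of :: "nat \<Rightarrow> real mat \<Rightarrow> bool" where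
  \<comment> \<open>Not \<open>orthogonal_mat\<close> of the library, which does not require unit columns.\<close>
  "orthogonal_matrix_of k V \<longleftrightarrow> V \<in> carrier_mat k k \<and>
     transpose_mat V * V = 1\<^sub>m k \<and> V * transpose_mat V = 1\<^sub>m k"

definition block :: "nat \<Rightarrow> nat \<Rightarrow> real mat \<Rightarrow> nat \<Rightarrow> nat \<Rightarrow> real mat" where
  "block p q M t s = mat p q (\<lambda>(a, b). M $$ (t * p + a, s * q + b))"

definition block_lower_triangular ::
    "nat \<Rightarrow> nat \<Rightarrow> nat \<Rightarrow> nat \<Rightarrow> real mat \<Rightarrow> bool" where
  "block_lower_triangular K p K' q M \<longleftrightarrow> M \<in> carrier_mat (K * p) (K' * q) \<and>
     (\<forall>t<K. \<forall>s<K'. t < s \<longrightarrow> block p q M t s = 0\<^sub>m p q)"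

section \<open>Random vectors\<close>

definition cross_cov ::
    "'w measure \<Rightarrow> nat \<Rightarrow> nat \<Rightarrow> ('w \<Rightarrow> real vec) \<Rightarrow> ('w \<Rightarrow> real vec) \<Rightarrow> real mat" where
  "cross_cov M p q X Y = mat p q (\<lambda>(a, b).
     \<integral>\<omega>. (X \<omega> $ a - (\<integral>\<eta>. X \<eta> $ a \<partial>M)) * (Y \<omega> $ b - (\<integral>\<eta>. Y \<eta> $ b \<partial>M)) \<partial>M)"

text \<open>The normal law $N(\mu,\Sigma)$ for positive definite $\Sigma$: every nonzero linear
  functional of \<open>X\<close> has the corresponding one-dimensional normal density.\<close>

definition gaussian_vec ::
    "'w measure \<Rightarrow> nat \<Rightarrow> ('w \<Rightarrow> real vec) \<Rightarrow> real vec \<Rightarrow> real mat \<Rightarrow> bool" where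
  "gaussian_vec M k X \<mu> Sig \<longleftrightarrow> (\<forall>\<omega> \<in> space M. X \<omega> \<in> carrier_vec k) \<and>
     (\<forall>a \<in> carrier_vec k. a \<noteq> 0\<^sub>v k \<longrightarrow>
        distributed M lborel (\<lambda>\<omega>. scalar_prod a (X \<omega>))
          (normal_density (scalar_prod a \<mu>) (sqrt (scalar_prod a (Sig *\<^sub>v a)))))"

section \<open>Networked systems\<close>

text \<open>Subsystems are numbered \<open>0, \<dots>, N - 1\<close>. The global disturbance \<open>noise D t\<close> is the random
  vector $w_t$; \<open>Bloc D t i\<close> is $B_t^i$, and \<open>Scov D i\<close> is $S_i$.\<close>

record 'w steering =
  nsub :: nat
  xdim :: "nat \<Rightarrow> nat"
  udim :: "nat \<Rightarrow> nat"
  horizon :: nat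
  Amat :: "nat \<Rightarrow> real mat"
  Bloc :: "nat \<Rightarrow> nat \<Rightarrow> real mat"
  pspace :: "'w measure"
  init :: "'w \<Rightarrow> real vec"
  noise :: "nat \<Rightarrow> 'w \<Rightarrow> real vec"
  Scov :: "nat \<Rightarrow> real mat"
  mu0 :: "real vec"
  muf :: "real vec"
  Sig0 :: "real mat"
  Sigf :: "real mat"
  Qcost :: "nat \<Rightarrow> real mat"
  Rcost :: "nat \<Rightarrow> real mat"
  locality :: nat

definition offset :: "(nat \<Rightarrow> nat) \<Rightarrow> nat \<Rightarrow> nat" where
  "offset f i = (\<Sum>j<i. f j)"

definition nx :: "'w steering \<Rightarrow> nat" where
  "nx D = (\<Sum>i<nsub D. xdim D i)"

definition nu :: "'w steering \<Rightarrow> nat" where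
  "nu D = (\<Sum>i<nsub D. udim D i)"

definition Ablock :: "'w steering \<Rightarrow> nat \<Rightarrow> nat \<Rightarrow> nat \<Rightarrow> real mat" where
  "Ablock D t i j = mat (xdim D i) (xdim D j)
     (\<lambda>(a, b). Amat D t $$ (offset (xdim D) i + a, offset (xdim D) j + b))"

definition local_noise :: "'w steering \<Rightarrow> nat \<Rightarrow> nat \<Rightarrow> 'w \<Rightarrow> real vec" where
  "local_noise D t i \<omega> = vec (xdim D i) (\<lambda>a. noise D t \<omega> $ (offset (xdim D) i + a))"

definition Bmat :: "'w steering \<Rightarrow> nat \<Rightarrow> real mat" where
  "Bmat D t = diag_block_mat (map (Bloc D t) [0..<nsub D])"

definition Wcov :: "'w steering \<Rightarrow> nat \<Rightarrow> real mat" where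
  "Wcov D t = cross_cov (pspace D) (nx D) (nx D) (noise D t) (noise D t)"

text \<open>White noise: the values of \<open>local_noise D t i\<close> at distinct times are uncorrelated.\<close>

definition steering_problem :: "'w steering \<Rightarrow> bool" where
  "steering_problem D \<longleftrightarrow>
     (\<forall>t<horizon D. Amat D t \<in> carrier_mat (nx D) (nx D)) \<and>
     (\<forall>t<horizon D. \<forall>i<nsub D. Bloc D t i \<in> carrier_mat (xdim D i) (udim D i)) \<and>
     prob_space (pspace D) \<and>
     gaussian_vec (pspace D) (nx D) (init D) (mu0 D) (Sig0 D) \<and>
     (\<forall>t<horizon D. \<forall>\<omega> \<in> space (pspace D). noise D t \<omega> \<in> carrier_vec (nx D)) \<and>
     (\<forall>i<nsub D. Scov D i \<in> pd_mats (xdim D i)) \<and>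
     (\<forall>t<horizon D. \<forall>i<nsub D.
        gaussian_vec (pspace D) (xdim D i) (local_noise D t i) (0\<^sub>v (xdim D i)) (Scov D i)) \<and>
     (\<forall>t<horizon D. \<forall>s<horizon D. \<forall>i<nsub D. t \<noteq> s \<longrightarrow>
        cross_cov (pspace D) (xdim D i) (xdim D i) (local_noise D t i) (local_noise D s i)
          = 0\<^sub>m (xdim D i) (xdim D i)) \<and>
     mu0 D \<in> carrier_vec (nx D) \<and> muf D = 0\<^sub>v (nx D) \<and>
     Sig0 D \<in> pd_mats (nx D) \<and> Sigf D \<in> pd_mats (nx D) \<and>
     (\<forall>t<horizon D. Qcost D t \<in> psd_mats (nx D)) \<and>
     (\<forall>t<horizon D. Rcost D t \<in> pd_mats (nu D))"

section \<open>Stacked matrices\<close>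

definition hx :: "'w steering \<Rightarrow> nat" where
  "hx D = (horizon D + 1) * nx D"

definition bigA :: "'w steering \<Rightarrow> real mat" where
  "bigA D = (let A = diag_block_mat (map (Amat D) [0..<horizon D]) in
     four_block_mat A (0\<^sub>m (horizon D * nx D) (nx D)) (0\<^sub>m 0 (horizon D * nx D)) (0\<^sub>m 0 (nx D)))"

definition bigB :: "'w steering \<Rightarrow> real mat" where
  "bigB D = diag_block_mat (map (Bmat D) [0..<horizon D])"

definition shiftZ :: "'w steering \<Rightarrow> real mat" where
  "shiftZ D = mat (hx D) (horizon D * nx D) (\<lambda>(a, b). if a = b + nx D then 1 else 0)"

definition ZAB :: "'w steering \<Rightarrow> real mat" where
  "ZAB D = four_block_mat (1\<^sub>m (hx D) - shiftZ D * bigA D) (- (shiftZ D * bigB D))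
     (0\<^sub>m 0 (hx D)) (0\<^sub>m 0 (horizon D * nu D))"

definition bigF :: "'w steering \<Rightarrow> real mat" where
  "bigF D = diag_block_mat
     [diag_block_mat (map (Qcost D) [0..<horizon D] @ [0\<^sub>m (nx D) (nx D)]),
      diag_block_mat (map (Rcost D) [0..<horizon D])]"

text \<open>Block columns are counted from 0, so \<open>selP D t\<close> picks $x_t$ out of $[x_0;\dots;x_T]$.\<close>

definition selP :: "'w steering \<Rightarrow> nat \<Rightarrow> real mat" where
  "selP D t = mat (nx D) (hx D) (\<lambda>(a, b). if b = t * nx D + a then 1 else 0)"

definition mu_w :: "'w steering \<Rightarrow> real vec" where
  "mu_w D = mu0 D @\<^sub>v 0\<^sub>v (horizon D * nx D)"

definition Sigma_w :: "'w steering \<Rightarrow> real mat" where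
  "Sigma_w D = diag_block_mat (Sig0 D # map (Wcov D) [0..<horizon D])"

definition Theta :: "'w steering \<Rightarrow> real mat" where
  "Theta D = Sigma_w D + mat_of_cols (hx D) [mu_w D] * transpose_mat (mat_of_cols (hx D) [mu_w D])"

definition system_responses :: "'w steering \<Rightarrow> real mat \<Rightarrow> real mat \<Rightarrow> bool" where
  "system_responses D X U \<longleftrightarrow>
     block_lower_triangular (horizon D + 1) (nx D) (horizon D + 1) (nx D) X \<and>
     block_lower_triangular (horizon D) (nu D) (horizon D + 1) (nx D) U"

section \<open>Locality\<close>

definition edges :: "'w steering \<Rightarrow> (nat \<times> nat) set" where
  "edges D = {(i, j). i < nsub D \<and> j < nsub D \<and>
     (\<exists>t<horizon D. Ablock D t j i \<noteq> 0\<^sub>m (xdim D j) (xdim D i))}"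

definition sys_dist :: "'w steering \<Rightarrow> nat \<Rightarrow> nat \<Rightarrow> enat" where
  "sys_dist D i j = (INF k \<in> {k. (i, j) \<in> edges D ^^ k}. enat k)"

definition outgoing :: "'w steering \<Rightarrow> nat \<Rightarrow> nat \<Rightarrow> nat set" where
  "outgoing D i d = {j. j < nsub D \<and> sys_dist D i j \<le> enat d}"

text \<open>If the rows of \<open>M\<close> are \<open>K\<close> stacked copies of a global signal with local dimensions \<open>r\<close>, and
  its columns \<open>K'\<close> copies of one with local dimensions \<open>c\<close>, then \<open>response_block\<close> collects the
  rows of subsystem \<open>i\<close> and the columns of subsystem \<open>j\<close> over all times.\<close>

definition response_block ::
    "nat \<Rightarrow> nat \<Rightarrow> (nat \<Rightarrow> nat) \<Rightarrow> nat \<Rightarrow> (nat \<Rightarrow> nat) \<Rightarrow> real mat \<Rightarrow> nat \<Rightarrow> nat \<Rightarrow> real mat" where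
  "response_block N K r K' c M i j = mat (K * r i) (K' * c j) (\<lambda>(a, b).
     M $$ ((a div r i) * offset r N + offset r i + a mod r i,
           (b div c j) * offset c N + offset c j + b mod c j))"

definition localized :: "'w steering \<Rightarrow> nat \<Rightarrow> nat \<Rightarrow> (nat \<Rightarrow> nat) \<Rightarrow> real mat \<Rightarrow> bool" where
  "localized D d K r M \<longleftrightarrow> (\<forall>j<nsub D. \<forall>i<nsub D. i \<notin> outgoing D j d \<longrightarrow>
     response_block (nsub D) K r (horizon D + 1) (xdim D) M i j
       = 0\<^sub>m (K * r i) ((horizon D + 1) * xdim D j))"

definition locality_constraint :: "'w steering \<Rightarrow> real mat set \<Rightarrow> bool" where
  "locality_constraint D L \<longleftrightarrow>
     VectorSpace.subspace class_ring L
       (module_mat TYPE(real) (hx D + horizon D * nu D) (hx D)) \<and>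
     (\<forall>X U. system_responses D X U \<longrightarrow> X @\<^sub>r U \<in> L \<longrightarrow>
        localized D (locality D) (horizon D + 1) (xdim D) X \<and>
        localized D (locality D + 1) (horizon D) (udim D) U)"

section \<open>The two optimization problems\<close>

definition terminal_lmi :: "'w steering \<Rightarrow> real mat \<Rightarrow> bool" where
  "terminal_lmi D X \<longleftrightarrow> (let Y = selP D (horizon D) * X * psd_sqrt (Sigma_w D) in
     four_block_mat (Sigf D) Y (transpose_mat Y) (1\<^sub>m (hx D)) \<in> psd_mats (nx D + hx D))"

definition sls_cost :: "'w steering \<Rightarrow> real mat \<Rightarrow> real mat \<Rightarrow> real" where
  "sls_cost D X U = (frob_norm (psd_sqrt (bigF D) * (X @\<^sub>r U) * psd_sqrt (Theta D)))\<^sup>2"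

definition sls_feasible :: "'w steering \<Rightarrow> real mat set \<Rightarrow> real mat \<Rightarrow> real mat \<Rightarrow> bool" where
  "sls_feasible D L X U \<longleftrightarrow> system_responses D X U \<and>
     ZAB D * (X @\<^sub>r U) = 1\<^sub>m (hx D) \<and>
     X @\<^sub>r U \<in> L \<and>
     (selP D (horizon D) * X * transpose_mat (selP D 0)) *\<^sub>v mu0 D = muf D \<and>
     terminal_lmi D X"

definition sls_solution :: "'w steering \<Rightarrow> real mat set \<Rightarrow> real mat \<Rightarrow> real mat \<Rightarrow> bool" where
  "sls_solution D L X U \<longleftrightarrow>
     is_arg_min (\<lambda>(X, U). sls_cost D X U) (\<lambda>(X, U). sls_feasible D L X U) (X, U)"

definition eig_cost :: "'w steering \<Rightarrow> real mat \<Rightarrow> real mat \<Rightarrow> real mat \<Rightarrow> real" where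
  "eig_cost D Lam X U = (frob_norm (psd_sqrt (bigF D) * (X @\<^sub>r U) * psd_sqrt Lam))\<^sup>2"

definition eig_feasible ::
    "'w steering \<Rightarrow> real mat set \<Rightarrow> real mat \<Rightarrow> real mat \<Rightarrow> real mat \<Rightarrow> bool" where
  "eig_feasible D L V X U \<longleftrightarrow> system_responses D X U \<and>
     ZAB D * (X @\<^sub>r U) = V \<and>
     (X @\<^sub>r U) * transpose_mat V \<in> L \<and>
     (selP D (horizon D) * X * transpose_mat V * transpose_mat (selP D 0)) *\<^sub>v mu0 D = muf D \<and>
     (let Y = selP D (horizon D) * X * transpose_mat V * psd_sqrt (Sigma_w D) in
        four_block_mat (Sigf D) Y (transpose_mat Y) (1\<^sub>m (hx D)) \<in> psd_mats (nx D + hx D))"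

definition eig_solution ::
    "'w steering \<Rightarrow> real mat set \<Rightarrow> real mat \<Rightarrow> real mat \<Rightarrow> real mat \<Rightarrow> real mat \<Rightarrow> bool" where
  "eig_solution D L V Lam X U \<longleftrightarrow>
     is_arg_min (\<lambda>(X, U). eig_cost D Lam X U) (\<lambda>(X, U). eig_feasible D L V X U) (X, U)"

text \<open>The characteristic polynomial identity says that the diagonal of \<open>Lam\<close> lists the
  eigenvalues of \<open>M\<close> with multiplicity.\<close>

definition eigendecomposition :: "nat \<Rightarrow> real mat \<Rightarrow> real mat \<Rightarrow> real mat \<Rightarrow> bool" where
  "eigendecomposition k M V Lam \<longleftrightarrow> orthogonal_matrix_of k V \<and>
     Lam \<in> carrier_mat k k \<and> diagonal_mat Lam \<and>
     char_poly M = (\<Prod>a \<leftarrow> diag_mat Lam. [:- a, 1:]) \<and>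
     M = V * Lam * transpose_mat V"

end

theory Submission
  imports Defs
begin

text \<open>The dynamics constraint exhibits \<open>V\<close> as a product of block-lower-triangular matrices; being
  also orthogonal, \<open>V\<close> is block-diagonal. Hence right multiplication by \<open>V\<close> and by its transpose
  preserves block-lower-triangularity, and the substitution $\Phi = \Psi V^\top$ is a bijection
  between the feasible sets. It preserves the cost because $\Theta^{1/2} = V \Lambda^{1/2} V^\top$
  and the Frobenius norm is orthogonally invariant.\<close>

section \<open>Positive semidefinite square roots\<close>

text \<open>Nothing in an eigendecomposition ties the order of the eigenvectors to the time blocks,
  and for a general \<open>V\<close> multiplying a response by the transpose can destroy causality.
  What excludes this is that the transformed problem has a feasible point at all; as
  \<open>V\<close> is fixed, that one point settles the matter for every competitor. The cost needs
  more than algebra because \<open>psd_sqrt\<close> is a definite description, meaningful only once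
  a root is known to exist and to be unique. Uniqueness is proved in general; existence is proved
  for diagonal matrices and carried from \<open>Lam\<close> to \<open>Theta D\<close> by congruence.
  This asks for \<open>Lam\<close> to be positive semidefinite, hence for \<open>Theta D\<close>,
  hence for each \<open>Wcov D t\<close>. Here the Gaussian hypotheses enter: a Bochner integral
  that does not converge takes a default value, so formal covariances can be trusted to form a
  positive semidefinite matrix only after second moments are shown finite.\<close>

lemma trace_mult_comm:
  fixes A B :: "'a::comm_semiring_0 mat"
  assumes "A \<in> carrier_mat p q" "B \<in> carrier_mat q p"
  shows "(\<Sum>i<p. (A * B) $$ (i, i)) = (\<Sum>j<q. (B * A) $$ (j, j))"
proof -
  have "(\<Sum>i<p. (A * B) $$ (i, i)) = (\<Sum>i<p. \<Sum>j<q. A $$ (i, j) * B $$ (j, i))"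
    using assms by (intro sum.cong) (auto simp: scalar_prod_def lessThan_atLeast0)
  also have "\<dots> = (\<Sum>j<q. \<Sum>i<p. B $$ (j, i) * A $$ (i, j))"
    by (subst sum.swap) (simp add: mult.commute)
  also have "\<dots> = (\<Sum>j<q. (B * A) $$ (j, j))"
    using assms by (intro sum.cong) (auto simp: scalar_prod_def lessThan_atLeast0)
  finally show ?thesis .
qed

lemma scalar_prod_self_eq_0:
  fixes v :: "real vec"
  assumes "v \<in> carrier_vec k" "v \<bullet> v = 0"
  shows "v = 0\<^sub>v k"
proof (rule eq_vecI)
  fix i assume "i < dim_vec (0\<^sub>v k)"
  then show "v $ i = 0\<^sub>v k $ i"
    using assms by (auto simp: scalar_prod_def sum_nonneg_eq_0_iff)
qed (use assms in auto)

lemma scalar_prod_self_nonneg: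
  fixes v :: "real vec"
  shows "0 \<le> v \<bullet> v"
  by (auto simp: scalar_prod_def intro!: sum_nonneg)

lemma scalar_prod_mult_mat_vec_sym:
  fixes M :: "real mat"
  assumes "M \<in> carrier_mat k k" "transpose_mat M = M" "v \<in> carrier_vec k" "w \<in> carrier_vec k"
  shows "v \<bullet> (M *\<^sub>v w) = w \<bullet> (M *\<^sub>v v)"
  using transpose_vec_mult_scalar[OF assms(1,4,3)] assms
    comm_scalar_prod[of "M *\<^sub>v v" k w] by auto

text \<open>Moving from \<open>v\<close> in the direction \<open>- M v\<close> changes the quadratic
  form at first order by \<open>- 2 s |M v|^2\<close>. As the form starts at 0 and cannot become
  negative, \<open>M v\<close> must vanish.\<close>

lemma psd_mats_kernel:
  assumes M: "M \<in> psd_mats k" and v: "v \<in> carrier_vec k" and z: "v \<bullet> (M *\<^sub>v v) = 0"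
  shows "M *\<^sub>v v = 0\<^sub>v k"
proof (rule scalar_prod_self_eq_0)
  define w where "w = M *\<^sub>v v"
  have Mc: "M \<in> carrier_mat k k" and sym: "transpose_mat M = M"
    using M by (auto simp: psd_mats_def)
  have w: "w \<in> carrier_vec k" using Mc v by (auto simp: w_def)
  then show "M *\<^sub>v v \<in> carrier_vec k" by (simp add: w_def)
  define c where "c = w \<bullet> w"
  define e where "e = w \<bullet> (M *\<^sub>v w)"
  have c: "0 \<le> c" unfolding c_def by (rule scalar_prod_self_nonneg)
  have e: "0 \<le> e" using M w unfolding e_def psd_mats_def by auto
  have vMw: "v \<bullet> (M *\<^sub>v w) = c"
    using scalar_prod_mult_mat_vec_sym[OF Mc sym v w] by (simp add: c_def w_def)
  have Mw: "M *\<^sub>v w \<in> carrier_vec k" using Mc w by auto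
  have ineq: "0 \<le> s\<^sup>2 * e - 2 * s * c" for s
  proof -
    have "M *\<^sub>v (v - s \<cdot>\<^sub>v w) = w - s \<cdot>\<^sub>v (M *\<^sub>v w)"
      using Mc v w by (simp add: mult_minus_distrib_mat_vec[OF Mc] mult_mat_vec[OF Mc] w_def)
    then have "(v - s \<cdot>\<^sub>v w) \<bullet> (M *\<^sub>v (v - s \<cdot>\<^sub>v w)) = (v - s \<cdot>\<^sub>v w) \<bullet> (w - s \<cdot>\<^sub>v (M *\<^sub>v w))"
      by simp
    also have "\<dots> = v \<bullet> w - s * (v \<bullet> (M *\<^sub>v w)) - s * (w \<bullet> w) + s * (s * (w \<bullet> (M *\<^sub>v w)))"
      using v w Mw
      by (simp add: minus_scalar_prod_distrib[of _ k] scalar_prod_minus_distrib[of _ k] algebra_simps)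
    also have "\<dots> = s\<^sup>2 * e - 2 * s * c"
      using z vMw by (simp add: c_def e_def power2_eq_square algebra_simps flip: w_def)
    finally show ?thesis
      using M v w unfolding psd_mats_def by (metis (no_types, lifting) mem_Collect_eq minus_carrier_vec smult_carrier_vec)
  qed
  \<comment> \<open>The minimizer of the quadratic is \<open>c / e\<close>, which breaks down for
    \<open>e = 0\<close>. The step \<open>c / (e + 1)\<close> is always defined and still makes the
    value negative unless \<open>c = 0\<close>.\<close>
  have "(c / (e + 1))\<^sup>2 * e - 2 * (c / (e + 1)) * c
      = (c\<^sup>2 * e - 2 * c\<^sup>2 * (e + 1)) / (e + 1)\<^sup>2"
    using e by (simp add: divide_simps) (simp add: power2_eq_square algebra_simps)
  with ineq[of "c / (e + 1)"] have "0 \<le> (c\<^sup>2 * e - 2 * c\<^sup>2 * (e + 1)) / (e + 1)\<^sup>2"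
    by simp
  then have "0 \<le> c\<^sup>2 * e - 2 * c\<^sup>2 * (e + 1)"
    using e by (simp add: zero_le_divide_iff)
  then have "c\<^sup>2 * (e + 2) \<le> 0" by (simp add: algebra_simps)
  then have "c = 0" using e by (simp add: mult_le_0_iff)
  then show "(M *\<^sub>v v) \<bullet> (M *\<^sub>v v) = 0" by (simp add: c_def w_def)
qed

text \<open>If $X^2 = Y^2$ and $E = X - Y$, then $XE + EY = 0$, so the sum of the nonnegative traces of
  $EXE$ and $EYE$ vanishes; hence $XE = YE = 0$ and $E^2 = 0$.\<close>

lemma psd_mats_sqrt_unique:
  assumes X: "X \<in> psd_mats k" and Y: "Y \<in> psd_mats k" and eq: "X * X = Y * Y"
  shows "X = Y"
proof -
  have Xc: "X \<in> carrier_mat k k" and Yc: "Y \<in> carrier_mat k k"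
    and Xs: "transpose_mat X = X" and Ys: "transpose_mat Y = Y"
    using X Y by (auto simp: psd_mats_def)
  define E where "E = X - Y"
  have Ec: "E \<in> carrier_mat k k" using Xc Yc by (auto simp: E_def)
  have Es: "transpose_mat E = E"
    using Xs Ys Xc Yc by (simp add: E_def transpose_minus[OF Xc Yc])
  have "X * E = X * X - X * Y" "E * Y = X * Y - Y * Y"
    using Xc Yc by (simp_all add: E_def mult_minus_distrib_mat minus_mult_distrib_mat)
  then have XE: "X * E = - (E * Y)"
    using Xc Yc eq by (intro eq_matI) auto
  \<comment> \<open>Symmetry of \<open>E\<close> splits the trace of \<open>E M E\<close> into
    values of the quadratic form of \<open>M\<close> at the columns of \<open>E\<close>. Each is
    nonnegative, so a zero total lets \<open>psd_mats_kernel\<close> act column by column.\<close>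
  have quad: "(\<Sum>j<k. (E * (M * E)) $$ (j, j)) = (\<Sum>j<k. col E j \<bullet> (M *\<^sub>v col E j))"
    if "M \<in> carrier_mat k k" for M
  proof (intro sum.cong refl)
    fix j assume "j \<in> {..<k}"
    then show "(E * (M * E)) $$ (j, j) = col E j \<bullet> (M *\<^sub>v col E j)"
      using that Ec Es col_mult2[OF that Ec, of j] row_transpose[of j E] by simp
  qed
  have "(\<Sum>j<k. (E * (X * E)) $$ (j, j)) = - (\<Sum>j<k. (E * (E * Y)) $$ (j, j))"
    using Ec Yc by (simp add: XE sum_negf)
  also have "(\<Sum>j<k. (E * (E * Y)) $$ (j, j)) = (\<Sum>j<k. (E * (Y * E)) $$ (j, j))"
    using trace_mult_comm[of E k k "E * Y"] Ec Yc by (simp add: assoc_mult_mat[of _ k k _ k _ k])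
  finally have tot: "(\<Sum>j<k. col E j \<bullet> (X *\<^sub>v col E j)) + (\<Sum>j<k. col E j \<bullet> (Y *\<^sub>v col E j)) = 0"
    using quad[OF Xc] quad[OF Yc] by simp
  have nn: "0 \<le> col E j \<bullet> (M *\<^sub>v col E j)" if "M \<in> psd_mats k" for M j
    using that Ec by (auto simp: psd_mats_def)
  have "M * E = 0\<^sub>m k k" if "M = X \<or> M = Y" for M
  proof -
    have M: "M \<in> psd_mats k" "M \<in> carrier_mat k k" using that X Y Xc Yc by auto
    have "(\<Sum>j<k. col E j \<bullet> (M *\<^sub>v col E j)) = 0"
      using tot that sum_nonneg[of "{..<k}", OF nn[OF X]] sum_nonneg[of "{..<k}", OF nn[OF Y]]
      by (auto simp: add_nonneg_eq_0_iff)
    then have "M *\<^sub>v col E j = 0\<^sub>v k" if "j < k" for j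
      using that nn[OF M(1)] Ec M(1)
      by (intro psd_mats_kernel) (auto simp: sum_nonneg_eq_0_iff)
    then have "row M i \<bullet> col E j = 0" if "i < k" "j < k" for i j
      using that M(2) by (metis carrier_matD(1) index_mult_mat_vec index_zero_vec(1))
    then show ?thesis
      using M(2) Ec by (intro eq_matI) auto
  qed
  then have "E * E = 0\<^sub>m k k"
    using Xc Yc Ec minus_mult_distrib_mat[OF Xc Yc Ec] by (auto simp: E_def[symmetric])
  \<comment> \<open>Row \<open>j\<close> of the symmetric \<open>E\<close> is its column
    \<open>j\<close>, so the diagonal of \<open>E * E\<close> holds the squared lengths of the
    columns.\<close>
  then have "col E j \<bullet> col E j = 0" if "j < k" for j
    using that Ec Es by (metis carrier_matD index_mult_mat(1) index_zero_mat(1) row_transpose)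
  then have "col E j = 0\<^sub>v k" if "j < k" for j
    using that Ec scalar_prod_self_eq_0 by (metis carrier_matD(1) col_carrier_vec that)
  then have "E $$ (i, j) = 0" if "i < k" "j < k" for i j
    using that Ec by (metis carrier_matD index_col index_zero_vec(1))
  then show ?thesis
    using Xc Yc unfolding E_def by (intro eq_matI) auto
qed

lemma psd_sqrt_eqI:
  assumes "X \<in> psd_mats k" "X * X = M"
  shows "psd_sqrt M = X"
proof -
  have "dim_row M = k" using assms by (auto simp: psd_mats_def)
  then show ?thesis
    unfolding psd_sqrt_def using assms
    by (intro the_equality) (auto intro: psd_mats_sqrt_unique)
qed

text \<open>The form of \<open>W M W^T\<close> at \<open>v\<close> is the form of \<open>M\<close>
  at \<open>W^T v\<close>. A rectangular \<open>W\<close> is allowed, which also covers the rank-one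
  mean term of \<open>Theta D\<close>.\<close>

lemma psd_mats_congruence:
  assumes M: "M \<in> psd_mats k" and W: "W \<in> carrier_mat l k"
  shows "W * M * transpose_mat W \<in> psd_mats l"
proof -
  have Mc: "M \<in> carrier_mat k k" and sym: "transpose_mat M = M"
    using M by (auto simp: psd_mats_def)
  have "0 \<le> v \<bullet> (W * M * transpose_mat W *\<^sub>v v)" if v: "v \<in> carrier_vec l" for v
  proof -
    let ?u = "transpose_mat W *\<^sub>v v"
    have u: "?u \<in> carrier_vec k" using W v by auto
    have "W * M * transpose_mat W *\<^sub>v v = W *\<^sub>v (M *\<^sub>v ?u)"
      using W Mc v u by (simp add: assoc_mult_mat_vec[of _ l k] assoc_mult_mat_vec[of _ l k _ l])
    then have "v \<bullet> (W * M * transpose_mat W *\<^sub>v v) = ?u \<bullet> (M *\<^sub>v ?u)"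
      using transpose_vec_mult_scalar[OF W, of "M *\<^sub>v ?u" v] Mc u v by simp
    then show ?thesis using M u by (simp add: psd_mats_def)
  qed
  moreover have "transpose_mat (W * M * transpose_mat W) = W * M * transpose_mat W"
    using W Mc sym transpose_mult[of "W * M" l k "transpose_mat W" l] transpose_mult[OF W Mc]
      assoc_mult_mat[OF W Mc, of "transpose_mat W" l] by simp
  ultimately show ?thesis using W Mc by (auto simp: psd_mats_def)
qed

lemma diagonal_mat_mult_vec_index:
  fixes M :: "real mat"
  assumes "M \<in> carrier_mat k k" "diagonal_mat M" "v \<in> carrier_vec k" "i < k"
  shows "(M *\<^sub>v v) $ i = M $$ (i, i) * v $ i"
proof -
  have "(M *\<^sub>v v) $ i = (\<Sum>j\<in>{0..<k}. M $$ (i, j) * v $ j)"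
    using assms by (auto simp: scalar_prod_def)
  also have "\<dots> = (\<Sum>j\<in>{i}. M $$ (i, j) * v $ j)"
    using assms by (intro sum.mono_neutral_right) (auto simp: diagonal_mat_def)
  finally show ?thesis by simp
qed

lemma psd_mats_diagonal_nonneg:
  assumes "M \<in> psd_mats k" "diagonal_mat M" "i < k"
  shows "0 \<le> M $$ (i, i)"
proof -
  have M: "M \<in> carrier_mat k k" using assms by (auto simp: psd_mats_def)
  have "0 \<le> unit_vec k i \<bullet> (M *\<^sub>v unit_vec k i)"
    using assms by (auto simp: psd_mats_def)
  then show ?thesis
    using M assms by (simp add: scalar_prod_left_unit[of _ k] del: index_mult_mat_vec
      add: diagonal_mat_mult_vec_index[OF M])
qed

text \<open>Entrywise square roots of the nonnegative diagonal give a root explicitly, so the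
  definite description denotes something.\<close>

lemma psd_sqrt_diagonal:
  assumes "M \<in> psd_mats k" "diagonal_mat M"
  shows "psd_sqrt M \<in> psd_mats k" "psd_sqrt M * psd_sqrt M = M"
proof -
  define X where "X = mat k k (\<lambda>(i, j). if i = j then sqrt (M $$ (i, i)) else 0)"
  have Xc: "X \<in> carrier_mat k k" and Xd: "diagonal_mat X"
    by (auto simp: X_def diagonal_mat_def)
  have M: "M \<in> carrier_mat k k" using assms by (auto simp: psd_mats_def)
  have "0 \<le> v \<bullet> (X *\<^sub>v v)" if v: "v \<in> carrier_vec k" for v
  proof -
    have "v \<bullet> (X *\<^sub>v v) = (\<Sum>i<k. v $ i * (sqrt (M $$ (i, i)) * v $ i))"
      unfolding scalar_prod_def
    proof (intro sum.cong)
      fix i assume "i \<in> {..<k}"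
      then show "v $ i * (X *\<^sub>v v) $ i = v $ i * (sqrt (M $$ (i, i)) * v $ i)"
        by (simp only: lessThan_iff diagonal_mat_mult_vec_index[OF Xc Xd v]) (simp add: X_def)
    qed (use Xc in auto)
    then show ?thesis
      using psd_mats_diagonal_nonneg[OF assms]
      by (auto intro!: sum_nonneg simp: mult.left_commute[of "v $ _"])
  qed
  then have "X \<in> psd_mats k"
    unfolding psd_mats_def using Xc by (auto simp: X_def intro!: eq_matI)
  moreover have "X * X = M"
  proof (rule eq_matI)
    fix i j assume ij: "i < dim_row M" "j < dim_col M"
    have "(X * X) $$ (i, j) = (X *\<^sub>v col X j) $ i"
      using ij Xc M by auto
    also have "\<dots> = X $$ (i, i) * X $$ (i, j)"
      using ij Xc M by (subst diagonal_mat_mult_vec_index[OF Xc Xd]) auto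
    also have "\<dots> = M $$ (i, j)"
      using ij M assms psd_mats_diagonal_nonneg[OF assms]
      by (auto simp: X_def diagonal_mat_def)
    finally show "(X * X) $$ (i, j) = M $$ (i, j)" .
  qed (use Xc M in auto)
  ultimately show "psd_sqrt M \<in> psd_mats k" "psd_sqrt M * psd_sqrt M = M"
    using psd_sqrt_eqI by auto
qed

text \<open>In the square of \<open>V S V^T\<close> the inner \<open>V^T V\<close> cancels. The
  hypotheses on \<open>psd_sqrt M\<close> express that a root of \<open>M\<close> exists, which is
  what gets transported.\<close>

lemma psd_sqrt_orthogonal_congruence:
  assumes V: "orthogonal_matrix_of k V" and M: "psd_sqrt M \<in> psd_mats k" "psd_sqrt M * psd_sqrt M = M"
  shows "psd_sqrt (V * M * transpose_mat V) = V * psd_sqrt M * transpose_mat V"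
proof (rule psd_sqrt_eqI)
  let ?S = "psd_sqrt M"
  have Vc: "V \<in> carrier_mat k k" and VV: "transpose_mat V * V = 1\<^sub>m k"
    using V by (auto simp: orthogonal_matrix_of_def)
  have Vt: "transpose_mat V \<in> carrier_mat k k" using Vc by simp
  have S: "?S \<in> carrier_mat k k" using M by (auto simp: psd_mats_def)
  note a = assoc_mult_mat[of _ k k _ k _ k]
  have "V * ?S * transpose_mat V * (V * ?S * transpose_mat V)
      = V * ?S * (transpose_mat V * V) * ?S * transpose_mat V"
    using Vc Vt S by (simp add: a)
  also have "\<dots> = V * (?S * ?S) * transpose_mat V"
    using Vc Vt S by (simp add: VV a)
  finally show "V * ?S * transpose_mat V * (V * ?S * transpose_mat V) = V * M * transpose_mat V"
    by (simp add: M)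
  show "V * ?S * transpose_mat V \<in> psd_mats k"
    by (rule psd_mats_congruence[OF M(1) Vc])
qed

section \<open>The Frobenius norm under orthogonal factors, and products of nonconforming
  size\<close>

lemma frob_norm_eq_trace: "(frob_norm M)\<^sup>2 = (\<Sum>i<dim_row M. (M * transpose_mat M) $$ (i, i))"
proof -
  have "(frob_norm M)\<^sup>2 = (\<Sum>i<dim_row M. \<Sum>j<dim_col M. (M $$ (i, j))\<^sup>2)"
    unfolding frob_norm_def by (auto intro!: real_sqrt_pow2 sum_nonneg)
  also have "\<dots> = (\<Sum>i<dim_row M. (M * transpose_mat M) $$ (i, i))"
    by (auto simp: scalar_prod_def power2_eq_square lessThan_atLeast0 intro!: sum.cong)
  finally show ?thesis .
qed

text \<open>The squared norm depends on \<open>M\<close> only through \<open>M M^T\<close>, and in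
  \<open>M V^T V M^T\<close> the orthogonal factors cancel.\<close>

lemma frob_norm_mult_orthogonal:
  assumes "orthogonal_matrix_of k V" "dim_col M = k"
  shows "(frob_norm (M * transpose_mat V))\<^sup>2 = (frob_norm M)\<^sup>2"
proof -
  have V: "V \<in> carrier_mat k k" "transpose_mat V * V = 1\<^sub>m k"
    using assms by (auto simp: orthogonal_matrix_of_def)
  obtain r where M: "M \<in> carrier_mat r k" using assms by auto
  have Vt: "transpose_mat V \<in> carrier_mat k k" and Mt: "transpose_mat M \<in> carrier_mat k r"
    using V M by auto
  have "M * transpose_mat V * transpose_mat (M * transpose_mat V)
      = M * transpose_mat V * (V * transpose_mat M)"
    by (simp only: transpose_mult[OF M Vt] Matrix.transpose_transpose)
  also have "\<dots> = M * (transpose_mat V * (V * transpose_mat M))"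
    using V Mt by (intro assoc_mult_mat[OF M Vt]) auto
  also have "transpose_mat V * (V * transpose_mat M) = transpose_mat M"
    by (simp only: assoc_mult_mat[OF Vt V(1) Mt, symmetric] V(2) left_mult_one_mat[OF Mt])
  finally have "M * transpose_mat V * transpose_mat (M * transpose_mat V) = M * transpose_mat M" .
  then show ?thesis by (simp add: frob_norm_eq_trace)
qed

text \<open>The dimensions of \<open>A\<close> are arbitrary. With \<open>A = psd_sqrt (bigF D)\<close>, this avoids proving that
  \<open>bigF D\<close> has a square root at all, which would need the spectral theorem.\<close>

lemma mult_mat_assoc_nonconforming:
  fixes A B C :: "'a::semiring_0 mat"
  assumes B: "B \<in> carrier_mat p q" and C: "C \<in> carrier_mat q r"
  shows "A * B * C = A * (B * C)"
proof -
  \<comment> \<open>\<open>scalar_prod\<close> sums over the dimension of its second argument, so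
    \<open>A * M\<close> reads \<open>row A i $ j\<close> exactly for \<open>j < p\<close>.
    \<open>A'\<close> stores these values, unspecified ones included, in a matrix of conforming
    size.\<close>
  define A' where "A' = mat (dim_row A) p (\<lambda>(i, j). row A i $ j)"
  have eq: "A * M = A' * M" if "M \<in> carrier_mat p s" for M s
    using that by (intro eq_matI) (auto simp: A'_def scalar_prod_def)
  have A': "A' \<in> carrier_mat (dim_row A) p" by (simp add: A'_def)
  show ?thesis
    using eq[OF B] eq[OF mult_carrier_mat[OF B C]] assoc_mult_mat[OF A' B C] by simp
qed

section \<open>Block-lower-triangular orthogonal matrices\<close>

text \<open>An entrywise form with block positions found by division: products can be treated index
  by index, without extracting blocks, and the dimensions come from the matrix itself.\<close>

definition block_lower :: "nat \<Rightarrow> nat \<Rightarrow> 'a::zero mat \<Rightarrow> bool" where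
  "block_lower p q M \<longleftrightarrow>
     (\<forall>i<dim_row M. \<forall>j<dim_col M. i div p < j div q \<longrightarrow> M $$ (i, j) = 0)"

lemma block_lowerD:
  "block_lower p q M \<Longrightarrow> M \<in> carrier_mat k l \<Longrightarrow> i < k \<Longrightarrow> j < l \<Longrightarrow> i div p < j div q \<Longrightarrow> M $$ (i, j) = 0"
  by (auto simp: block_lower_def)

lemma mult_add_less_mult: "t * p + a < K * p" if "a < p" "t < K" for a p t K :: nat
proof -
  have "t * p + a < Suc t * p" using that by simp
  also have "\<dots> \<le> K * p" using that by (intro mult_le_mono1) simp
  finally show ?thesis .
qed

lemma block_lower_triangular_iff:
  "block_lower_triangular K p K' q M \<longleftrightarrow> M \<in> carrier_mat (K * p) (K' * q) \<and> block_lower p q M"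
proof (intro iffI conjI)
  assume *: "block_lower_triangular K p K' q M"
  then show M: "M \<in> carrier_mat (K * p) (K' * q)" by (simp add: block_lower_triangular_def)
  show "block_lower p q M"
    unfolding block_lower_def
  proof (intro allI impI)
    fix i j assume ij: "i < dim_row M" "j < dim_col M" "i div p < j div q"
    \<comment> \<open>A block size of 0 would leave no index at all, so \<open>div\<close> and
      \<open>mod\<close> only meet positive divisors.\<close>
    have pq: "0 < p" "0 < q" using ij M by (auto intro: gr0I)
    have "i div p < K" "j div q < K'"
      using ij M by (simp_all add: less_mult_imp_div_less)
    then have "block p q M (i div p) (j div q) = 0\<^sub>m p q"
      using * ij by (simp add: block_lower_triangular_def)
    moreover have "M $$ (i, j) = block p q M (i div p) (j div q) $$ (i mod p, j mod q)"
      using pq by (simp add: block_def)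
    ultimately show "M $$ (i, j) = 0" using pq by simp
  qed
next
  assume *: "M \<in> carrier_mat (K * p) (K' * q) \<and> block_lower p q M"
  have "block p q M t s = 0\<^sub>m p q" if "t < K" "s < K'" "t < s" for t s
    using that by (intro eq_matI)
      (auto simp: block_def mult_add_less_mult intro!: block_lowerD[OF conjunct2[OF *] conjunct1[OF *]])
  then show "block_lower_triangular K p K' q M"
    using * by (simp add: block_lower_triangular_def)
qed

text \<open>If row \<open>i\<close> lies in an earlier block than column \<open>j\<close>, a middle
  index lies either after the block of \<open>i\<close>, which kills the first factor, or before
  that of \<open>j\<close>, which kills the second.\<close>

lemma block_lower_mult:
  fixes M N :: "'a::semiring_0 mat"
  assumes "block_lower p q M" "block_lower q r N" "dim_col M = dim_row N"
  shows "block_lower p r (M * N)"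
  unfolding block_lower_def
proof (intro allI impI)
  fix i j assume ij: "i < dim_row (M * N)" "j < dim_col (M * N)" "i div p < j div r"
  have "M $$ (i, k) * N $$ (k, j) = 0" if k: "k < dim_row N" for k
  proof (cases "i div p < k div q")
    case True
    then show ?thesis using assms ij k by (simp add: block_lower_def)
  next
    case False
    then have "k div q < j div r" using ij by simp
    then show ?thesis using assms ij k by (simp add: block_lower_def)
  qed
  then show "(M * N) $$ (i, j) = 0"
    using ij assms by (simp add: scalar_prod_def)
qed

lemma block_lower_add:
  fixes M N :: "'a::monoid_add mat"
  assumes "block_lower p q M" "block_lower p q N" "M \<in> carrier_mat k l" "N \<in> carrier_mat k l"
  shows "block_lower p q (M + N)"
  using assms by (auto simp: block_lower_def)

lemma block_lower_minus:
  fixes M N :: "'a::group_add mat"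
  assumes "block_lower p q M" "block_lower p q N" "M \<in> carrier_mat k l" "N \<in> carrier_mat k l"
  shows "block_lower p q (M - N)"
  using assms by (auto simp: block_lower_def)

lemma block_lower_uminus:
  fixes M :: "'a::group_add mat"
  assumes "block_lower p q M"
  shows "block_lower p q (- M)"
  using assms by (auto simp: block_lower_def)

lemma block_lower_one: "block_lower p p (1\<^sub>m k)"
  by (auto simp: block_lower_def)

lemma diag_block_mat_carrier:
  assumes "\<And>A. A \<in> set As \<Longrightarrow> A \<in> carrier_mat p q"
  shows "diag_block_mat As \<in> carrier_mat (length As * p) (length As * q)"
  using assms
proof (induction As)
  case (Cons A As)
  then have "A \<in> carrier_mat p q" "diag_block_mat As \<in> carrier_mat (length As * p) (length As * q)"
    by auto
  then show ?case by (auto simp: Let_def)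
qed auto

lemma diag_block_mat_off_diagonal:
  assumes "\<And>A. A \<in> set As \<Longrightarrow> A \<in> carrier_mat p q"
    and "i < length As * p" "j < length As * q" "i div p \<noteq> j div q"
  shows "diag_block_mat As $$ (i, j) = 0"
  using assms
proof (induction As arbitrary: i j)
  case (Cons A As)
  have A: "A \<in> carrier_mat p q" using Cons.prems by simp
  have As: "diag_block_mat As \<in> carrier_mat (length As * p) (length As * q)"
    using Cons.prems by (intro diag_block_mat_carrier) simp
  have pq: "0 < p" "0 < q" using Cons.prems by (auto intro: gr0I)
  show ?case
  proof (cases "i < p \<or> j < q")
    case True
    then consider "i < p" "q \<le> j" | "p \<le> i" "j < q"
      using Cons.prems by fastforce
    then show ?thesis using Cons.prems(2,3) A As by cases (auto simp: Let_def)
  next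
    case False
    then have "diag_block_mat As $$ (i - p, j - q) = 0"
      using Cons.prems pq by (intro Cons.IH) (auto simp: le_div_geq)
    then show ?thesis using False Cons.prems(2,3) A As by (auto simp: Let_def)
  qed
qed auto

lemma block_lower_diag_block_mat:
  assumes "\<And>A. A \<in> set As \<Longrightarrow> A \<in> carrier_mat p q"
  shows "block_lower p q (diag_block_mat As)"
proof -
  have "diag_block_mat As \<in> carrier_mat (length As * p) (length As * q)"
    using assms by (rule diag_block_mat_carrier)
  then show ?thesis
    using diag_block_mat_off_diagonal[of As p q] assms by (auto simp: block_lower_def)
qed

text \<open>Every row and column of an orthogonal matrix has square sum 1. The first \<open>m\<close> rows, supported
  on the first \<open>m\<close> columns, already exhaust the square sum \<open>m\<close> of these columns.\<close>

lemma orthogonal_corner_zero: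
  assumes V: "orthogonal_matrix_of k V" and m: "m \<le> k"
    and z: "\<And>i j. i < m \<Longrightarrow> m \<le> j \<Longrightarrow> j < k \<Longrightarrow> V $$ (i, j) = 0"
    and ij: "m \<le> i" "i < k" "j < m"
  shows "V $$ (i, j) = 0"
proof -
  have Vc: "V \<in> carrier_mat k k" using V by (simp add: orthogonal_matrix_of_def)
  have row: "(\<Sum>b<k. (V $$ (a, b))\<^sup>2) = 1" if "a < k" for a
  proof -
    have "(\<Sum>b<k. (V $$ (a, b))\<^sup>2) = (V * transpose_mat V) $$ (a, a)"
      using that Vc by (simp add: scalar_prod_def power2_eq_square lessThan_atLeast0)
    then show ?thesis using V that by (simp add: orthogonal_matrix_of_def)
  qed
  have col: "(\<Sum>a<k. (V $$ (a, b))\<^sup>2) = 1" if "b < k" for b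
  proof -
    have "(\<Sum>a<k. (V $$ (a, b))\<^sup>2) = (transpose_mat V * V) $$ (b, b)"
      using that Vc by (simp add: scalar_prod_def power2_eq_square lessThan_atLeast0)
    then show ?thesis using V that by (simp add: orthogonal_matrix_of_def)
  qed
  have split: "(\<Sum>a<k. f a) = (\<Sum>a<m. f a) + (\<Sum>a=m..<k. f a)" for f :: "nat \<Rightarrow> real"
    using m by (simp add: lessThan_atLeast0 sum.atLeastLessThan_concat)
  have "(\<Sum>a<m. \<Sum>b<m. (V $$ (a, b))\<^sup>2) = (\<Sum>a<m. \<Sum>b<k. (V $$ (a, b))\<^sup>2)"
  proof (rule sum.cong[OF refl])
    fix a assume "a \<in> {..<m}"
    then have "(\<Sum>b=m..<k. (V $$ (a, b))\<^sup>2) = 0"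
      using z by (intro sum.neutral) auto
    then show "(\<Sum>b<m. (V $$ (a, b))\<^sup>2) = (\<Sum>b<k. (V $$ (a, b))\<^sup>2)"
      by (simp only: split)
  qed
  also have "\<dots> = m" using m by (simp add: row)
  finally have "(\<Sum>b<m. \<Sum>a<m. (V $$ (a, b))\<^sup>2) = m"
    by (subst sum.swap)
  moreover have "(\<Sum>b<m. \<Sum>a<k. (V $$ (a, b))\<^sup>2) = m" using m by (simp add: col)
  ultimately have "(\<Sum>b<m. \<Sum>a=m..<k. (V $$ (a, b))\<^sup>2) = 0"
    by (simp add: split sum.distrib)
  then show ?thesis
    using ij by (auto simp: sum_nonneg_eq_0_iff sum_nonneg)
qed

text \<open>At each block boundary the corner above the diagonal is zero, so by
  \<open>orthogonal_corner_zero\<close> the corner below it is zero too. Every entry below the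
  diagonal blocks lies in such a corner.\<close>

lemma block_lower_transpose_orthogonal:
  assumes V: "orthogonal_matrix_of (K * p) V" and bl: "block_lower p p V"
  shows "block_lower p p (transpose_mat V)"
  unfolding block_lower_def
proof (intro allI impI)
  fix j i assume *: "j < dim_row (transpose_mat V)" "i < dim_col (transpose_mat V)" "j div p < i div p"
  have Vc: "V \<in> carrier_mat (K * p) (K * p)" using V by (simp add: orthogonal_matrix_of_def)
  have p: "0 < p" using * Vc by (auto intro: gr0I)
  \<comment> \<open>The first index of the block of \<open>i\<close>: column \<open>j\<close>, in an
    earlier block, falls before this boundary, and row \<open>i\<close> does not.\<close>
  define m where "m = (i div p) * p"
  have mi: "m \<le> i" by (simp add: m_def)
  have "V $$ (i, j) = 0"
  proof (rule orthogonal_corner_zero[OF V])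
    show "m \<le> K * p" using mi * Vc by simp
    show "j < m" using *(3) p by (simp add: m_def div_less_iff_less_mult)
    fix a b assume "a < m" "m \<le> b" "b < K * p"
    moreover from this have "a div p < b div p"
      using p by (metis div_le_mono div_less_iff_less_mult less_le_trans m_def nonzero_mult_div_cancel_right not_gr_zero)
    ultimately show "V $$ (a, b) = 0"
      using \<open>m \<le> K * p\<close> by (intro block_lowerD[OF bl Vc]) auto
  qed (use mi * Vc in auto)
  then show "transpose_mat V $$ (j, i) = 0" using * by simp
qed

section \<open>Stacked responses and the dynamics constraint\<close>

lemma append_rows_mult:
  fixes X U M :: "'a::semiring_0 mat"
  assumes "X \<in> carrier_mat k l" "U \<in> carrier_mat k' l" "M \<in> carrier_mat l r"
  shows "(X @\<^sub>r U) * M = X * M @\<^sub>r U * M"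
  using assms unfolding append_rows_def
  by (intro eq_matI) (auto simp: scalar_prod_def row_def)

text \<open>A block row and a block column are both 2 x 2 block matrices with two empty blocks, so
  the product rule for four blocks applies.\<close>

lemma row_blocks_mult_append_rows:
  fixes A B X U :: "'a::semiring_0 mat"
  assumes "A \<in> carrier_mat k l" "B \<in> carrier_mat k l'" "X \<in> carrier_mat l r" "U \<in> carrier_mat l' r"
  shows "four_block_mat A B (0\<^sub>m 0 l) (0\<^sub>m 0 l') * (X @\<^sub>r U) = A * X + B * U"
proof -
  have "X @\<^sub>r U = four_block_mat X (0\<^sub>m l 0) U (0\<^sub>m l' 0)"
    using assms by (simp add: append_rows_def)
  then have "four_block_mat A B (0\<^sub>m 0 l) (0\<^sub>m 0 l') * (X @\<^sub>r U)
      = four_block_mat (A * X + B * U) (A * 0\<^sub>m l 0 + B * 0\<^sub>m l' 0)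
          (0\<^sub>m 0 l * X + 0\<^sub>m 0 l' * U) (0\<^sub>m 0 l * 0\<^sub>m l 0 + 0\<^sub>m 0 l' * 0\<^sub>m l' 0)"
    using assms by (simp add: mult_four_block_mat[of A k l B l' _ 0 _ X r _ 0])
  also have "\<dots> = A * X + B * U"
    using assms by (intro eq_matI) auto
  finally show ?thesis .
qed

text \<open>The product is \<open>(I - Z A) X - Z B U\<close>. All factors are
  block-lower-triangular, with block sizes \<open>nx D\<close> and \<open>nu D\<close> that match
  along each product, so the result is block-lower-triangular in \<open>nx D\<close> blocks.\<close>

lemma block_lower_ZAB_mult:
  assumes D: "steering_problem D" and XU: "system_responses D X U"
  shows "block_lower (nx D) (nx D) (ZAB D * (X @\<^sub>r U))"
proof -
  let ?T = "horizon D" and ?n = "nx D" and ?m = "nu D"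
  have X: "X \<in> carrier_mat (hx D) (hx D)" "block_lower ?n ?n X"
    and U: "U \<in> carrier_mat (?T * ?m) (hx D)" "block_lower ?m ?n U"
    using XU by (auto simp: system_responses_def block_lower_triangular_iff hx_def)
  \<comment> \<open>The nonzero entries sit at row \<open>b + nx D\<close>, column \<open>b\<close>,
    and adding \<open>nx D\<close> cannot lower the block index.\<close>
  have Z: "shiftZ D \<in> carrier_mat (hx D) (?T * ?n)" "block_lower ?n ?n (shiftZ D)"
    using div_le_mono[OF le_add1, of _ ?n ?n] by (auto simp: shiftZ_def block_lower_def not_less[symmetric])
  have As: "A \<in> carrier_mat ?n ?n" if "A \<in> set (map (Amat D) [0..<?T])" for A
    using that D by (auto simp: steering_problem_def)
  have A: "bigA D \<in> carrier_mat (?T * ?n) (hx D)" "block_lower ?n ?n (bigA D)"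
  proof -
    let ?A = "diag_block_mat (map (Amat D) [0..<?T])"
    have "?A \<in> carrier_mat (?T * ?n) (?T * ?n)"
      using diag_block_mat_carrier[of "map (Amat D) [0..<?T]", OF As] by simp
    moreover have "block_lower ?n ?n ?A"
      by (rule block_lower_diag_block_mat[OF As])
    ultimately show "bigA D \<in> carrier_mat (?T * ?n) (hx D)" "block_lower ?n ?n (bigA D)"
      by (auto simp: bigA_def Let_def block_lower_def hx_def)
  qed
  have Bt: "Bmat D t \<in> carrier_mat ?n ?m" if "t < ?T" for t
  proof -
    have "Bloc D t i \<in> carrier_mat (xdim D i) (udim D i)" if "i < nsub D" for i
      using D \<open>t < ?T\<close> that by (simp add: steering_problem_def)
    then have "map (dim_row \<circ> Bloc D t) [0..<nsub D] = map (xdim D) [0..<nsub D]"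
      "map (dim_col \<circ> Bloc D t) [0..<nsub D] = map (udim D) [0..<nsub D]"
      by fastforce+
    then show ?thesis
      unfolding Bmat_def carrier_mat_def
      by (simp add: dim_diag_block_mat nx_def nu_def interv_sum_list_conv_sum_set_nat lessThan_atLeast0)
  qed
  have Bs: "B \<in> carrier_mat ?n ?m" if "B \<in> set (map (Bmat D) [0..<?T])" for B
    using that Bt by auto
  have B: "bigB D \<in> carrier_mat (?T * ?n) (?T * ?m)" "block_lower ?n ?m (bigB D)"
    using diag_block_mat_carrier[of "map (Bmat D) [0..<?T]", OF Bs]
      block_lower_diag_block_mat[of "map (Bmat D) [0..<?T]", OF Bs]
    by (simp_all add: bigB_def)
  let ?L = "1\<^sub>m (hx D) - shiftZ D * bigA D" and ?R = "- (shiftZ D * bigB D)"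
  have ZA: "shiftZ D * bigA D \<in> carrier_mat (hx D) (hx D)" and L: "?L \<in> carrier_mat (hx D) (hx D)"
    and R: "?R \<in> carrier_mat (hx D) (?T * ?m)"
    using Z A B by auto
  have "block_lower ?n ?n (shiftZ D * bigA D)" "block_lower ?n ?m (shiftZ D * bigB D)"
    using Z A B by (auto intro: block_lower_mult)
  then have bl: "block_lower ?n ?n ?L" "block_lower ?n ?m ?R"
    using ZA by (auto intro: block_lower_minus block_lower_uminus block_lower_one)
  have "block_lower ?n ?n (?L * X)" "block_lower ?n ?n (?R * U)"
    using block_lower_mult[OF bl(1) X(2)] block_lower_mult[OF bl(2) U(2)] L R X(1) U(1)
    by (simp_all only: carrier_matD)
  moreover have "?L * X \<in> carrier_mat (hx D) (hx D)" "?R * U \<in> carrier_mat (hx D) (hx D)"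
    using L R X U by auto
  ultimately have "block_lower ?n ?n (?L * X + ?R * U)"
    by (rule block_lower_add)
  then show ?thesis
    unfolding ZAB_def using row_blocks_mult_append_rows[OF L R X(1) U(1)] by simp
qed

lemma system_responses_mult:
  assumes "system_responses D X U" "M \<in> carrier_mat (hx D) (hx D)" "block_lower (nx D) (nx D) M"
  shows "system_responses D (X * M) (U * M)"
  using assms unfolding system_responses_def block_lower_triangular_iff hx_def
  by (auto intro!: block_lower_mult)

section \<open>The second moment matrix of the noise\<close>

lemma psd_mats_carrier: "M \<in> psd_mats k \<Longrightarrow> M \<in> carrier_mat k k"
  by (simp add: psd_mats_def)

lemma pd_mats_imp_psd_mats: "M \<in> pd_mats k \<Longrightarrow> M \<in> psd_mats k"
  unfolding pd_mats_def psd_mats_def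
  by (force simp: less_eq_real_def)

lemma psd_mats_one: "1\<^sub>m k \<in> psd_mats k"
  by (auto simp: psd_mats_def scalar_prod_self_nonneg)

lemma psd_mats_add:
  assumes "M \<in> psd_mats k" "N \<in> psd_mats k"
  shows "M + N \<in> psd_mats k"
proof -
  have c: "M \<in> carrier_mat k k" "N \<in> carrier_mat k k"
    using assms by (auto simp: psd_mats_def)
  have "0 \<le> v \<bullet> ((M + N) *\<^sub>v v)" if v: "v \<in> carrier_vec k" for v
  proof -
    have "M *\<^sub>v v \<in> carrier_vec k" "N *\<^sub>v v \<in> carrier_vec k" using c v by auto
    then have "v \<bullet> ((M + N) *\<^sub>v v) = v \<bullet> (M *\<^sub>v v) + v \<bullet> (N *\<^sub>v v)"
      using add_mult_distrib_mat_vec[OF c v] scalar_prod_add_distrib[OF v] by simp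
    then show ?thesis using assms v by (simp add: psd_mats_def)
  qed
  moreover have "transpose_mat (M + N) = M + N"
    using transpose_add[OF c] assms by (simp add: psd_mats_def)
  ultimately show ?thesis using c by (simp add: psd_mats_def)
qed

lemma psd_mats_block_diag:
  assumes A: "A \<in> psd_mats k" and B: "B \<in> psd_mats l"
  shows "four_block_mat A (0\<^sub>m k l) (0\<^sub>m l k) B \<in> psd_mats (k + l)"
proof -
  let ?M = "four_block_mat A (0\<^sub>m k l) (0\<^sub>m l k) B"
  have Ac: "A \<in> carrier_mat k k" and Bc: "B \<in> carrier_mat l l"
    using A B by (auto simp: psd_mats_def)
  have "0 \<le> v \<bullet> (?M *\<^sub>v v)" if v: "v \<in> carrier_vec (k + l)" for v
  proof -
    define a b where "a = vec_first v k" and "b = vec_last v l"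
    have v: "v = a @\<^sub>v b" and a: "a \<in> carrier_vec k" and b: "b \<in> carrier_vec l"
      using v by (simp_all add: a_def b_def)
    have "?M *\<^sub>v v = (A *\<^sub>v a) @\<^sub>v (B *\<^sub>v b)"
      unfolding v using Ac Bc a b
      by (subst four_block_mat_mult_vec[OF Ac _ _ Bc a b]) auto
    then have "v \<bullet> (?M *\<^sub>v v) = a \<bullet> (A *\<^sub>v a) + b \<bullet> (B *\<^sub>v b)"
      unfolding v using Ac Bc a b by (simp add: scalar_prod_append[of _ k _ l])
    then show ?thesis using A B a b by (simp add: psd_mats_def)
  qed
  moreover have "transpose_mat ?M = ?M"
    using transpose_four_block_mat[OF Ac _ _ Bc, of "0\<^sub>m k l" "0\<^sub>m l k"] A B
    by (simp add: psd_mats_def)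
  ultimately show ?thesis using Ac Bc by (auto simp: psd_mats_def)
qed

lemma psd_mats_diag_block_mat:
  assumes "\<And>A. A \<in> set As \<Longrightarrow> A \<in> psd_mats k"
  shows "diag_block_mat As \<in> psd_mats (length As * k)"
  using assms
proof (induction As)
  case Nil
  then show ?case by (auto simp: psd_mats_def scalar_prod_def)
next
  case (Cons A As)
  then have A: "A \<in> psd_mats k" and As: "diag_block_mat As \<in> psd_mats (length As * k)"
    by auto
  then show ?case
    using psd_mats_block_diag[OF A As] psd_mats_carrier[OF A] psd_mats_carrier[OF As]
    by (simp add: Let_def)
qed

section \<open>Covariance matrices and the coordinates of Gaussian vectors\<close>

text \<open>The product is dominated through \<open>|x y| \<le> x^2 + y^2\<close>; the terms created
  by centering are integrable because the measure is finite.\<close>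

lemma (in prob_space) integrable_centered_mult:
  fixes f g :: "'a \<Rightarrow> real"
  assumes "random_variable borel f" "integrable M (\<lambda>\<omega>. (f \<omega>)\<^sup>2)"
    and "random_variable borel g" "integrable M (\<lambda>\<omega>. (g \<omega>)\<^sup>2)"
  shows "integrable M (\<lambda>\<omega>. (f \<omega> - c) * (g \<omega> - d))"
proof -
  have f: "integrable M f" and g: "integrable M g"
    using assms by (auto intro: square_integrable_imp_integrable)
  have "integrable M (\<lambda>\<omega>. f \<omega> * g \<omega>)"
  proof (rule Bochner_Integration.integrable_bound)
    show "integrable M (\<lambda>\<omega>. (f \<omega>)\<^sup>2 + (g \<omega>)\<^sup>2)" using assms by simp
    have "\<bar>x * y\<bar> \<le> x\<^sup>2 + y\<^sup>2" for x y :: real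
      using sum_squares_bound[of "\<bar>x\<bar>" "\<bar>y\<bar>"] abs_ge_zero[of "x * y"]
      by (simp only: abs_mult power2_abs)
    then show "AE \<omega> in M. norm (f \<omega> * g \<omega>) \<le> norm ((f \<omega>)\<^sup>2 + (g \<omega>)\<^sup>2)" by simp
  qed (use assms in measurable)
  moreover have "(\<lambda>\<omega>. (f \<omega> - c) * (g \<omega> - d)) = (\<lambda>\<omega>. f \<omega> * g \<omega> - d * f \<omega> - c * g \<omega> + c * d)"
    by (auto simp: algebra_simps)
  ultimately show ?thesis using f g by simp
qed

text \<open>The quadratic form at \<open>v\<close> is the integral of the square of the centered
  linear functional given by \<open>v\<close>. Integrability of the products justifies moving the
  double sum under the integral.\<close>

lemma cross_cov_psd_mats:
  assumes "prob_space M"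
    and meas: "\<And>a. a < k \<Longrightarrow> (\<lambda>\<omega>. X \<omega> $ a) \<in> borel_measurable M"
    and sq: "\<And>a. a < k \<Longrightarrow> integrable M (\<lambda>\<omega>. (X \<omega> $ a)\<^sup>2)"
  shows "cross_cov M k k X X \<in> psd_mats k"
proof -
  interpret prob_space M by fact
  define c where "c a \<omega> = X \<omega> $ a - (\<integral>\<eta>. X \<eta> $ a \<partial>M)" for a \<omega>
  have int: "integrable M (\<lambda>\<omega>. c a \<omega> * c b \<omega>)" if "a < k" "b < k" for a b
    unfolding c_def using that meas sq by (intro integrable_centered_mult) auto
  have C: "cross_cov M k k X X = mat k k (\<lambda>(a, b). \<integral>\<omega>. c a \<omega> * c b \<omega> \<partial>M)"
    by (simp add: cross_cov_def c_def)
  have "0 \<le> v \<bullet> (cross_cov M k k X X *\<^sub>v v)" if v: "v \<in> carrier_vec k" for v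
  proof -
    have "v \<bullet> (cross_cov M k k X X *\<^sub>v v)
        = (\<Sum>a<k. \<Sum>b<k. v $ a * v $ b * (\<integral>\<omega>. c a \<omega> * c b \<omega> \<partial>M))"
      using v by (simp add: C scalar_prod_def lessThan_atLeast0 sum_distrib_left mult_ac)
    also have "\<dots> = (\<integral>\<omega>. (\<Sum>a<k. \<Sum>b<k. v $ a * v $ b * (c a \<omega> * c b \<omega>)) \<partial>M)"
    proof (subst Bochner_Integration.integral_sum)
      show "integrable M (\<lambda>\<omega>. \<Sum>b<k. v $ a * v $ b * (c a \<omega> * c b \<omega>))" if "a \<in> {..<k}" for a
        using that int by auto
      show "(\<Sum>a<k. \<Sum>b<k. v $ a * v $ b * (\<integral>\<omega>. c a \<omega> * c b \<omega> \<partial>M))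
          = (\<Sum>a<k. \<integral>\<omega>. (\<Sum>b<k. v $ a * v $ b * (c a \<omega> * c b \<omega>)) \<partial>M)"
        using int by (intro sum.cong refl, subst Bochner_Integration.integral_sum) auto
    qed
    also have "\<dots> = (\<integral>\<omega>. (\<Sum>a<k. v $ a * c a \<omega>)\<^sup>2 \<partial>M)"
      by (simp add: power2_eq_square sum_product mult_ac)
    finally show ?thesis by simp
  qed
  moreover have "transpose_mat (cross_cov M k k X X) = cross_cov M k k X X"
    by (intro eq_matI) (auto simp: C mult.commute)
  ultimately show ?thesis by (auto simp: psd_mats_def C)
qed

text \<open>A coordinate is the linear functional given by a unit vector. Positive definiteness of
  \<open>S\<close> makes its standard deviation positive, so the moments of the normal density are
  available.\<close>

lemma gaussian_vec_component:
  assumes "prob_space M" and X: "gaussian_vec M k X \<mu> S" and S: "S \<in> pd_mats k" and a: "a < k"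
  shows "(\<lambda>\<omega>. X \<omega> $ a) \<in> borel_measurable M" "integrable M (\<lambda>\<omega>. (X \<omega> $ a)\<^sup>2)"
proof -
  interpret prob_space M by fact
  define e :: "real vec" where "e = unit_vec k a"
  define m s where "m = e \<bullet> \<mu>" and "s = sqrt (e \<bullet> (S *\<^sub>v e))"
  have e: "e \<in> carrier_vec k" "e \<noteq> 0\<^sub>v k"
    using a unit_vec_nonzero[of k a] by (auto simp: e_def)
  then have s: "0 < s" using S by (simp add: s_def pd_mats_def)
  have D: "distributed M lborel (\<lambda>\<omega>. e \<bullet> X \<omega>) (normal_density m s)"
    using X e unfolding gaussian_vec_def m_def s_def by auto
  have eX: "e \<bullet> X \<omega> = X \<omega> $ a" if "\<omega> \<in> space M" for \<omega>
    using X that a by (simp add: gaussian_vec_def e_def scalar_prod_left_unit[of _ k])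
  have "(\<lambda>\<omega>. e \<bullet> X \<omega>) \<in> borel_measurable M"
    using distributed_measurable[OF D] by simp
  then show meas: "(\<lambda>\<omega>. X \<omega> $ a) \<in> borel_measurable M"
    by (subst measurable_cong[of M _ "\<lambda>\<omega>. e \<bullet> X \<omega>"]) (auto simp: eX)
  have "integrable M (\<lambda>\<omega>. (e \<bullet> X \<omega> - m)\<^sup>2)"
    using distributed_integrable[OF D, of "\<lambda>x. (x - m)\<^sup>2"] integrable_normal_moment[OF s, of m 2] by simp
  moreover have "integrable M (\<lambda>\<omega>. e \<bullet> X \<omega>)"
    using distributed_integrable[OF D, of "\<lambda>x. x"] integrable_normal_moment_nz_1[OF s, of m] by simp
  \<comment> \<open>The known moment is centered at \<open>m\<close>; expanding the square recovers
    the raw second moment.\<close>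
  ultimately have "integrable M (\<lambda>\<omega>. (e \<bullet> X \<omega> - m)\<^sup>2 + 2 * m * (e \<bullet> X \<omega>) - m\<^sup>2)"
    by simp
  also have "(\<lambda>\<omega>. (e \<bullet> X \<omega> - m)\<^sup>2 + 2 * m * (e \<bullet> X \<omega>) - m\<^sup>2) = (\<lambda>\<omega>. (e \<bullet> X \<omega>)\<^sup>2)"
    by (auto simp: power2_eq_square algebra_simps)
  finally show "integrable M (\<lambda>\<omega>. (X \<omega> $ a)\<^sup>2)"
    by (subst Bochner_Integration.integrable_cong[of M M _ "\<lambda>\<omega>. (e \<bullet> X \<omega>)\<^sup>2"]) (auto simp: eX)
qed

text \<open>The index ranges of the subsystems tile the global range. This carries facts about each
  \<open>local_noise\<close> to every coordinate of the global noise.\<close>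

lemma offset_decompose:
  assumes "k < offset f N"
  obtains i a where "i < N" "a < f i" "k = offset f i + a"
  using assms
proof (induction N arbitrary: thesis)
  case (Suc N)
  show ?case
  proof (cases "k < offset f N")
    case True
    with Suc show ?thesis by (metis less_SucI)
  next
    case False
    with Suc.prems show ?thesis
      by (intro Suc.prems(1)[of N "k - offset f N"]) (auto simp: offset_def)
  qed
qed (simp add: offset_def)

text \<open>Noises of different subsystems may be correlated, so \<open>Wcov D t\<close> need not be
  block-diagonal in the \<open>Scov D i\<close>. Its positivity is that of a covariance matrix, for
  which square-integrable coordinates suffice.\<close>

lemma Wcov_psd_mats:
  assumes D: "steering_problem D" and t: "t < horizon D"
  shows "Wcov D t \<in> psd_mats (nx D)"
proof -
  have P: "prob_space (pspace D)" using D by (simp add: steering_problem_def)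
  have comp: "(\<lambda>\<omega>. noise D t \<omega> $ k) \<in> borel_measurable (pspace D)
      \<and> integrable (pspace D) (\<lambda>\<omega>. (noise D t \<omega> $ k)\<^sup>2)" if k: "k < nx D" for k
  proof -
    obtain i a where ia: "i < nsub D" "a < xdim D i" "k = offset (xdim D) i + a"
      using k offset_decompose[of k "xdim D" "nsub D"] by (auto simp: nx_def offset_def)
    have "gaussian_vec (pspace D) (xdim D i) (local_noise D t i) (0\<^sub>v (xdim D i)) (Scov D i)"
      "Scov D i \<in> pd_mats (xdim D i)"
      using D t ia by (auto simp: steering_problem_def)
    from gaussian_vec_component[OF P this ia(2)] show ?thesis
      using ia by (simp add: local_noise_def)
  qed
  then show ?thesis
    unfolding Wcov_def by (intro cross_cov_psd_mats[OF P]) auto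
qed

lemma Theta_psd_mats:
  assumes D: "steering_problem D"
  shows "Theta D \<in> psd_mats (hx D)"
proof -
  have "A \<in> psd_mats (nx D)" if "A \<in> set (Sig0 D # map (Wcov D) [0..<horizon D])" for A
    using that D Wcov_psd_mats[OF D] by (auto simp: steering_problem_def intro: pd_mats_imp_psd_mats)
  then have "Sigma_w D \<in> psd_mats (length (Sig0 D # map (Wcov D) [0..<horizon D]) * nx D)"
    unfolding Sigma_w_def by (rule psd_mats_diag_block_mat)
  then have "Sigma_w D \<in> psd_mats (hx D)"
    by (simp add: hx_def)
  \<comment> \<open>The mean term is the congruence of the 1 x 1 identity by the single column
    \<open>mu_w D\<close>.\<close>
  moreover have "mat_of_cols (hx D) [mu_w D] * transpose_mat (mat_of_cols (hx D) [mu_w D])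
      \<in> psd_mats (hx D)"
    using psd_mats_congruence[OF psd_mats_one mat_of_cols_carrier(1), of "hx D" "[mu_w D]"]
    by (simp add: right_mult_one_mat[OF mat_of_cols_carrier(1), of "hx D" "[mu_w D]", simplified])
  ultimately show ?thesis
    unfolding Theta_def by (rule psd_mats_add)
qed

text \<open>Undoing the orthogonal congruence gives \<open>Lam = V^T M V\<close>; the eigenvalues
  are therefore nonnegative and \<open>psd_sqrt_diagonal\<close> applies.\<close>

lemma eigendecomposition_psd_mats:
  assumes E: "eigendecomposition k M V Lam" and M: "M \<in> psd_mats k"
  shows "Lam \<in> psd_mats k"
proof -
  have V: "V \<in> carrier_mat k k" "transpose_mat V * V = 1\<^sub>m k" and L: "Lam \<in> carrier_mat k k"
    and eq: "M = V * Lam * transpose_mat V"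
    using E by (auto simp: eigendecomposition_def orthogonal_matrix_of_def)
  have Vt: "transpose_mat V \<in> carrier_mat k k" using V by simp
  have "transpose_mat V * (V * Lam * transpose_mat V) * V
      = (transpose_mat V * V) * Lam * (transpose_mat V * V)"
    using V(1) L Vt by (simp add: assoc_mult_mat[of _ k k _ k _ k])
  also have "\<dots> = Lam" using L by (simp add: V(2))
  finally show ?thesis
    using psd_mats_congruence[OF M Vt] by (simp add: eq)
qed

section \<open>The change of variables\<close>

lemma mult_orthogonal_eq_iff:
  assumes V: "orthogonal_matrix_of k V" and M: "M \<in> carrier_mat l k" and N: "N \<in> carrier_mat l k"
  shows "M * transpose_mat V = N \<longleftrightarrow> M = N * V"
proof -
  have c: "V \<in> carrier_mat k k" "transpose_mat V \<in> carrier_mat k k"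
    and e: "transpose_mat V * V = 1\<^sub>m k" "V * transpose_mat V = 1\<^sub>m k"
    using V by (auto simp: orthogonal_matrix_of_def)
  have "M * transpose_mat V * V = M" "N * V * transpose_mat V = N"
    using assoc_mult_mat[OF M c(2,1)] assoc_mult_mat[OF N c] M N by (simp_all add: e)
  then show ?thesis by metis
qed

text \<open>The locality, mean and terminal constraints are already phrased through
  \<open>X V^T\<close> and \<open>U V^T\<close>, so they agree after reassociation. Causality and
  the dynamics carry the content: the former uses the block structure of both \<open>V\<close> and
  its transpose, the latter only orthogonality.\<close>

lemma eig_feasible_iff_sls_feasible:
  assumes V: "orthogonal_matrix_of (hx D) V" and bl: "block_lower (nx D) (nx D) V"
    and X: "X \<in> carrier_mat (hx D) (hx D)" and U: "U \<in> carrier_mat (horizon D * nu D) (hx D)"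
  shows "eig_feasible D L V X U \<longleftrightarrow> sls_feasible D L (X * transpose_mat V) (U * transpose_mat V)"
proof -
  let ?W = "transpose_mat V"
  have Vc: "V \<in> carrier_mat (hx D) (hx D)" and W: "?W \<in> carrier_mat (hx D) (hx D)"
    using V by (auto simp: orthogonal_matrix_of_def)
  have blW: "block_lower (nx D) (nx D) ?W"
    using block_lower_transpose_orthogonal[of "horizon D + 1" "nx D" V] V bl by (simp add: hx_def)
  have XU: "X @\<^sub>r U \<in> carrier_mat (hx D + horizon D * nu D) (hx D)"
    using X U by (rule carrier_append_rows)
  have stack: "X * ?W @\<^sub>r U * ?W = (X @\<^sub>r U) * ?W"
    using append_rows_mult[OF X U W] by simp
  have P: "selP D (horizon D) \<in> carrier_mat (nx D) (hx D)" by (simp add: selP_def)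
  have PX: "selP D (horizon D) * (X * ?W) = selP D (horizon D) * X * ?W"
    using assoc_mult_mat[OF P X W] by simp
  have cancel: "X * ?W * V = X" "U * ?W * V = U"
    using mult_orthogonal_eq_iff[OF V X, of "X * ?W"] mult_orthogonal_eq_iff[OF V U, of "U * ?W"] X U W
    by simp_all
  have resp: "system_responses D X U \<longleftrightarrow> system_responses D (X * ?W) (U * ?W)"
    using system_responses_mult[OF _ W blW, of X U] system_responses_mult[OF _ Vc bl, of "X * ?W" "U * ?W"]
    by (auto simp: cancel)
  have "ZAB D * (X * ?W @\<^sub>r U * ?W) = 1\<^sub>m (hx D) \<longleftrightarrow> ZAB D * (X @\<^sub>r U) * ?W = 1\<^sub>m (hx D)"
    unfolding stack using mult_mat_assoc_nonconforming[OF XU W, of "ZAB D"] by simp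
  also have "\<dots> \<longleftrightarrow> ZAB D * (X @\<^sub>r U) = V"
  proof -
    have "ZAB D * (X @\<^sub>r U) \<in> carrier_mat (hx D) (hx D)"
      using X by (auto simp: ZAB_def shiftZ_def append_rows_def)
    from mult_orthogonal_eq_iff[OF V this one_carrier_mat] show ?thesis using Vc by simp
  qed
  finally have dyn: "ZAB D * (X * ?W @\<^sub>r U * ?W) = 1\<^sub>m (hx D) \<longleftrightarrow> ZAB D * (X @\<^sub>r U) = V" .
  show ?thesis
    unfolding eig_feasible_def sls_feasible_def terminal_lmi_def resp dyn PX
    by (simp only: stack)
qed

lemma sls_cost_eq_eig_cost:
  assumes D: "steering_problem D" and E: "eigendecomposition (hx D) (Theta D) V Lam"
    and X: "X \<in> carrier_mat (hx D) (hx D)" and U: "U \<in> carrier_mat (horizon D * nu D) (hx D)"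
  shows "sls_cost D (X * transpose_mat V) (U * transpose_mat V) = eig_cost D Lam X U"
proof -
  let ?W = "transpose_mat V" and ?F = "psd_sqrt (bigF D)" and ?S = "psd_sqrt Lam"
  have V: "orthogonal_matrix_of (hx D) V" and Lam: "diagonal_mat Lam"
    and Theta: "Theta D = V * Lam * ?W"
    using E by (auto simp: eigendecomposition_def)
  have Vc: "V \<in> carrier_mat (hx D) (hx D)" and W: "?W \<in> carrier_mat (hx D) (hx D)"
    and WV: "?W * V = 1\<^sub>m (hx D)"
    using V by (auto simp: orthogonal_matrix_of_def)
  have "Lam \<in> psd_mats (hx D)"
    using eigendecomposition_psd_mats[OF E Theta_psd_mats[OF D]] .
  note sqrt = psd_sqrt_diagonal[OF this Lam]
  have S: "?S \<in> carrier_mat (hx D) (hx D)" using sqrt(1) by (rule psd_mats_carrier)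
  have SW: "?S * ?W \<in> carrier_mat (hx D) (hx D)" using S W by simp
  have XU: "X @\<^sub>r U \<in> carrier_mat (hx D + horizon D * nu D) (hx D)"
    using X U by (rule carrier_append_rows)
  have XUS: "(X @\<^sub>r U) * ?S \<in> carrier_mat (hx D + horizon D * nu D) (hx D)"
    using XU S by simp
  \<comment> \<open>The root of \<open>Theta D\<close> is \<open>V * ?S * ?W\<close>, so
    \<open>?W * V\<close> cancels in the middle and a single orthogonal factor remains on the
    right.\<close>
  have "(X * ?W @\<^sub>r U * ?W) * psd_sqrt (Theta D) = (X @\<^sub>r U) * ?W * (V * (?S * ?W))"
    unfolding Theta psd_sqrt_orthogonal_congruence[OF V sqrt] append_rows_mult[OF X U W]
    using assoc_mult_mat[OF Vc S W] by simp
  also have "\<dots> = (X @\<^sub>r U) * (?W * V * (?S * ?W))"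
    using assoc_mult_mat[OF XU W mult_carrier_mat[OF Vc SW]] assoc_mult_mat[OF W Vc SW] by simp
  also have "\<dots> = (X @\<^sub>r U) * ?S * ?W"
    using assoc_mult_mat[OF XU S W] left_mult_one_mat[OF SW] by (simp add: WV)
  finally have eq: "(X * ?W @\<^sub>r U * ?W) * psd_sqrt (Theta D) = (X @\<^sub>r U) * ?S * ?W" .
  have Th: "psd_sqrt (Theta D) \<in> carrier_mat (hx D) (hx D)"
    unfolding Theta psd_sqrt_orthogonal_congruence[OF V sqrt] using Vc S W by simp
  have XUW: "X * ?W @\<^sub>r U * ?W \<in> carrier_mat (hx D + horizon D * nu D) (hx D)"
    using X U W by (intro carrier_append_rows) auto
  have "?F * (X * ?W @\<^sub>r U * ?W) * psd_sqrt (Theta D) = ?F * ((X @\<^sub>r U) * ?S) * ?W"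
    using mult_mat_assoc_nonconforming[OF XUW Th] mult_mat_assoc_nonconforming[OF XUS W]
    by (simp only: eq)
  also have "?F * ((X @\<^sub>r U) * ?S) = ?F * (X @\<^sub>r U) * ?S"
    using mult_mat_assoc_nonconforming[OF XU S] by simp
  finally show ?thesis
    unfolding sls_cost_def eig_cost_def
    using frob_norm_mult_orthogonal[OF V, of "?F * (X @\<^sub>r U) * ?S"] S by simp
qed

theorem proposition1:
  fixes D :: "'w steering" and L :: "real mat set"
    and V Lam Psi_x Psi_u :: "real mat"
  assumes "steering_problem D"
    and "locality_constraint D L"
    and "\<exists>Phi_x Phi_u. sls_feasible D L Phi_x Phi_u"
    and "eigendecomposition (hx D) (Theta D) V Lam"
    and "eig_solution D L V Lam Psi_x Psi_u"
  shows "sls_solution D L (Psi_x * transpose_mat V) (Psi_u * transpose_mat V)"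
proof -
  let ?W = "transpose_mat V"
  note D = assms(1) and E = assms(4)
  have V: "orthogonal_matrix_of (hx D) V"
    using E by (simp add: eigendecomposition_def)
  then have Vc: "V \<in> carrier_mat (hx D) (hx D)"
    by (simp add: orthogonal_matrix_of_def)
  have Psi: "eig_feasible D L V Psi_x Psi_u"
    and opt: "\<And>X U. eig_feasible D L V X U \<Longrightarrow> eig_cost D Lam Psi_x Psi_u \<le> eig_cost D Lam X U"
    using assms(5) by (auto simp: eig_solution_def is_arg_min_def not_less)
  have dims: "X \<in> carrier_mat (hx D) (hx D)" "U \<in> carrier_mat (horizon D * nu D) (hx D)"
    if "system_responses D X U" for X U
    using that by (auto simp: system_responses_def block_lower_triangular_def hx_def)
  have Psi_resp: "system_responses D Psi_x Psi_u" and ZPsi: "ZAB D * (Psi_x @\<^sub>r Psi_u) = V"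
    using Psi by (auto simp: eig_feasible_def)
  \<comment> \<open>The block structure of \<open>V\<close> is read off from the given solution and
    then serves for all competitors below.\<close>
  have bl: "block_lower (nx D) (nx D) V"
    using block_lower_ZAB_mult[OF D Psi_resp] by (simp add: ZPsi)
  note feas = eig_feasible_iff_sls_feasible[OF V bl, where L = L]
  note cost = sls_cost_eq_eig_cost[OF D E]
  have "sls_feasible D L (Psi_x * ?W) (Psi_u * ?W)"
    using feas[OF dims[OF Psi_resp]] Psi by simp
  moreover have "sls_cost D (Psi_x * ?W) (Psi_u * ?W) \<le> sls_cost D X U"
    if XU: "sls_feasible D L X U" for X U
  proof -
    have "system_responses D X U" using XU by (simp add: sls_feasible_def)
    note d = dims[OF this]
    \<comment> \<open>A competitor of the original problem is pulled back along the inverse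
      substitution, right multiplication by \<open>V\<close>, and compared there.\<close>
    have d': "X * V \<in> carrier_mat (hx D) (hx D)" "U * V \<in> carrier_mat (horizon D * nu D) (hx D)"
      using d Vc by auto
    have eq: "X * V * ?W = X" "U * V * ?W = U"
      using mult_orthogonal_eq_iff[OF V d'(1) d(1)] mult_orthogonal_eq_iff[OF V d'(2) d(2)] by auto
    then have "eig_feasible D L V (X * V) (U * V)"
      using feas[OF d'] XU by simp
    then show ?thesis
      using opt cost[OF dims[OF Psi_resp]] cost[OF d'] by (simp add: eq)
  qed
  ultimately show ?thesis
    by (auto simp: sls_solution_def is_arg_min_def not_less)
qed

end
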